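(* Let $m\in\{1,2,3,4\}$, let $c^{20},c^{11},c^{02},c^{10},c^{01}$ be real constants, and let $$L_0=c^{20}\,\partial_r^2+2c^{11}\,\partial_r\partial_s+c^{02}\,\partial_s^2+c^{10}\,\partial_r+c^{01}\,\partial_s .$$ Let $M$ be the compatibility boundary condition (CBC) matrix for $L_0$ (defined in the context) with either Dirichlet or Neumann boundary conditions, on a grid with spacings $\Delta r,\Delta s>0$. (a) On a left or right face: if $c^{20}>0$, then $M$ is nonsingular provided $\Delta r$ is sufficiently small, i.e. there is $\delta>0$ such that $M$ is nonsingular whenever $0<\Delta r<\delta$ and $\Delta s>0$. If moreover $c^{10}=0$, then $M$ is nonsingular for any $\Delta r,\Delta s>0$. (b) On a top or bottom face: if $c^{02}>0$, then $M$ is nonsingular provided $\Delta s$ is sufficiently small, i.e. there is $\delta>0$ such that $M$ is nonsingular whenever $0<\Delta s<\delta$ and $\Delta r>0$. If moreover $c^{01}=0$, then $M$ is nonsingular for any $\Delta r,\Delta s>0$.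
   Context: The parameter domain is the unit square with coordinates $(r,s)$. The left/right faces are $r=0$ and $r=1$; the bottom/top faces are $s=0$ and $s=1$. At a (non-corner) boundary grid point $(r_i,s_j)$ the numerical solution is represented by a polynomial $$\bar u(r,s)=\sum_{l_1=0}^{2m+1}\sum_{l_2=0}^{2m+1}\bar u_{l_1,l_2}R^{l_1}S^{l_2},\qquad R=\frac{r-r_i}{\Delta r},\quad S=\frac{s-s_j}{\Delta s},$$ with $4(m+1)^2$ unknown coefficients $\bar u_{l_1,l_2}$. These are determined by a square linear system $M\bar{\mathbf u}=\mathbf b$, where $\bar{\mathbf u}$ is the vector of the $\bar u_{l_1,l_2}$ and $\mathbf b$ contains given data. Each row of $M$ is the coefficient row (with respect to the unknowns) of one of the following linear functionals of $\bar u$. For the left face $r_i=0$: (i) The $2(m+1)^2$ interpolation (matching) functionals $$\sum_{l_1=\alpha}^{2m+1}\sum_{l_2=\beta}^{2m+1}\binom{l_1}{\alpha}\binom{l_2}{\beta}\Big(\tfrac12\Big)^{l_1-\alpha}\Big(\pm\tfrac12\Big)^{l_2-\beta}\bar u_{l_1,l_2},\qquad \alpha,\beta=0,\dots,m,$$ for both choices of sign. These are the scaled derivatives $\frac{\Delta r^\alpha\Delta s^\beta}{\alpha!\,\beta!}\partial_r^\alpha\partial_s^\beta\bar u$ at the two neighbouring interior cell centers $(r_i+\Delta r/2,\;s_j\pm\Delta s/2)$. (ii) The $2(m+1)^2$ CBC functionals, for $q=0,\dots,m$ and $\alpha=0,\dots,2m+1$: - Dirichlet: $\partial_s^\alpha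 L_0^q\bar u(r_i,s_j)$. - Neumann: $\partial_s^\alpha\,\partial_n L_0^q\bar u(r_i,s_j)$, where $\partial_n=b_1\partial_r+b_2\partial_s$ is the normal derivative written in parameter coordinates, with constant (frozen) coefficients $b_1,b_2$ and $b_1\neq0$. For the right face $r_i=1$ the definition is the same, with the matching functionals taken at the interior cell centers $(r_i-\Delta r/2,\;s_j\pm\Delta s/2)$, i.e. with $(\tfrac12)^{l_1-\alpha}$ replaced by $(-\tfrac12)^{l_1-\alpha}$. For the bottom/top faces the roles of $r$ and $s$ are interchanged: the matching functionals are at the two neighbouring interior cell centers, the CBC functionals are $\partial_r^\alpha L_0^q\bar u$ or $\partial_r^\alpha\partial_nL_0^q\bar u$ at $(r_i,s_j)$, and $\partial_n=b_1\partial_r+b_2\partial_s$ with $b_2\ne0$. The coefficients of $L_0$ and of $\partial_n$ and the integer $m$ are fixed when "sufficiently small" is interpreted. *)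

theory Defs
  imports "HOL-Analysis.Derivative" "Jordan_Normal_Form.Matrix"
begin

definition pd_r :: "(real \<Rightarrow> real \<Rightarrow> real) \<Rightarrow> real \<Rightarrow> real \<Rightarrow> real" where
  "pd_r f r s = deriv (\<lambda>x. f x s) r"

definition pd_s :: "(real \<Rightarrow> real \<Rightarrow> real) \<Rightarrow> real \<Rightarrow> real \<Rightarrow> real" where
  "pd_s f r s = deriv (\<lambda>y. f r y) s"

definition L0 :: "real \<Rightarrow> real \<Rightarrow> real \<Rightarrow> real \<Rightarrow> real \<Rightarrow>
    (real \<Rightarrow> real \<Rightarrow> real) \<Rightarrow> real \<Rightarrow> real \<Rightarrow> real" where
  "L0 c20 c11 c02 c10 c01 f r s =
     c20 * pd_r (pd_r f) r s + 2 * c11 * pd_r (pd_s f) r s + c02 * pd_s (pd_s f) r s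
     + c10 * pd_r f r s + c01 * pd_s f r s"

datatype face = LeftFace | RightFace | BottomFace | TopFace

text \<open>The arguments of \<open>Neumann\<close> are the frozen coefficients \<open>b1\<close>, \<open>b2\<close> of the normal
  derivative \<open>b1 \<partial>\<^sub>r + b2 \<partial>\<^sub>s\<close>.\<close>

datatype bcond = Dirichlet | Neumann real real

fun bc_op :: "bcond \<Rightarrow> (real \<Rightarrow> real \<Rightarrow> real) \<Rightarrow> real \<Rightarrow> real \<Rightarrow> real" where
  "bc_op Dirichlet f r s = f r s"
| "bc_op (Neumann b1 b2) f r s = b1 * pd_r f r s + b2 * pd_s f r s"

fun admissible_bc :: "face \<Rightarrow> bcond \<Rightarrow> bool" where
  "admissible_bc fc Dirichlet \<longleftrightarrow> True"
| "admissible_bc fc (Neumann b1 b2) \<longleftrightarrow>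
     (if fc \<in> {LeftFace, RightFace} then b1 \<noteq> 0 else b2 \<noteq> 0)"

fun noncorner_point :: "face \<Rightarrow> real \<Rightarrow> real \<Rightarrow> bool" where
  "noncorner_point LeftFace ri sj \<longleftrightarrow> ri = 0 \<and> 0 < sj \<and> sj < 1"
| "noncorner_point RightFace ri sj \<longleftrightarrow> ri = 1 \<and> 0 < sj \<and> sj < 1"
| "noncorner_point BottomFace ri sj \<longleftrightarrow> sj = 0 \<and> 0 < ri \<and> ri < 1"
| "noncorner_point TopFace ri sj \<longleftrightarrow> sj = 1 \<and> 0 < ri \<and> ri < 1"

fun tangential :: "face \<Rightarrow> (real \<Rightarrow> real \<Rightarrow> real) \<Rightarrow> real \<Rightarrow> real \<Rightarrow> real" where
  "tangential LeftFace = pd_s"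
| "tangential RightFace = pd_s"
| "tangential BottomFace = pd_r"
| "tangential TopFace = pd_r"

text \<open>Directions \<open>(\<sigma>, \<tau>)\<close> of the two neighbouring interior cell centres, which are the points
  \<open>(r\<^sub>i + \<sigma> \<Delta>r / 2, s\<^sub>j + \<tau> \<Delta>s / 2)\<close>.\<close>

fun centers :: "face \<Rightarrow> (real \<times> real) list" where
  "centers LeftFace = [(1, 1), (1, -1)]"
| "centers RightFace = [(-1, 1), (-1, -1)]"
| "centers BottomFace = [(1, 1), (-1, 1)]"
| "centers TopFace = [(1, -1), (-1, -1)]"

text \<open>Functionals act on the array \<open>U\<close> of unknown coefficients, \<open>U l1 l2\<close> being the coefficient of
  \<open>R^l1 * S^l2\<close>.\<close>

definition ubar :: "nat \<Rightarrow> real \<Rightarrow> real \<Rightarrow> real \<Rightarrow> real \<Rightarrow> (nat \<Rightarrow> nat \<Rightarrow> real) \<Rightarrow>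
    real \<Rightarrow> real \<Rightarrow> real" where
  "ubar m \<Delta>r \<Delta>s ri sj U r s =
     (\<Sum>l1 = 0..2*m+1. \<Sum>l2 = 0..2*m+1. U l1 l2 * ((r - ri) / \<Delta>r) ^ l1 * ((s - sj) / \<Delta>s) ^ l2)"

definition matching_functional :: "nat \<Rightarrow> real \<times> real \<Rightarrow> nat \<Rightarrow> nat \<Rightarrow>
    (nat \<Rightarrow> nat \<Rightarrow> real) \<Rightarrow> real" where
  "matching_functional m d \<alpha> \<beta> U =
     (\<Sum>l1 = \<alpha>..2*m+1. \<Sum>l2 = \<beta>..2*m+1.
        real (l1 choose \<alpha>) * real (l2 choose \<beta>)
        * (fst d / 2) ^ (l1 - \<alpha>) * (snd d / 2) ^ (l2 - \<beta>) * U l1 l2)"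

definition cbc_functional :: "nat \<Rightarrow> ((real \<Rightarrow> real \<Rightarrow> real) \<Rightarrow> real \<Rightarrow> real \<Rightarrow> real) \<Rightarrow>
    face \<Rightarrow> bcond \<Rightarrow> real \<Rightarrow> real \<Rightarrow> real \<Rightarrow> real \<Rightarrow> nat \<Rightarrow> nat \<Rightarrow>
    (nat \<Rightarrow> nat \<Rightarrow> real) \<Rightarrow> real" where
  "cbc_functional m L fc bc \<Delta>r \<Delta>s ri sj q \<alpha> U =
     (tangential fc ^^ \<alpha>) (bc_op bc ((L ^^ q) (ubar m \<Delta>r \<Delta>s ri sj U))) ri sj"

definition cbc_rows :: "nat \<Rightarrow> ((real \<Rightarrow> real \<Rightarrow> real) \<Rightarrow> real \<Rightarrow> real \<Rightarrow> real) \<Rightarrow>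
    face \<Rightarrow> bcond \<Rightarrow> real \<Rightarrow> real \<Rightarrow> real \<Rightarrow> real \<Rightarrow> ((nat \<Rightarrow> nat \<Rightarrow> real) \<Rightarrow> real) list" where
  "cbc_rows m L fc bc \<Delta>r \<Delta>s ri sj =
     [matching_functional m d \<alpha> \<beta>. d \<leftarrow> centers fc, \<alpha> \<leftarrow> [0..<m+1], \<beta> \<leftarrow> [0..<m+1]]
     @ [cbc_functional m L fc bc \<Delta>r \<Delta>s ri sj q \<alpha>. q \<leftarrow> [0..<m+1], \<alpha> \<leftarrow> [0..<2*m+2]]"

definition cbc_cols :: "nat \<Rightarrow> (nat \<times> nat) list" where
  "cbc_cols m = List.product [0..<2*m+2] [0..<2*m+2]"

definition unit_coeff :: "nat \<times> nat \<Rightarrow> nat \<Rightarrow> nat \<Rightarrow> real" where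
  "unit_coeff l l1 l2 = (if l = (l1, l2) then 1 else 0)"

text \<open>The coefficient of an unknown in a (linear) functional is the value of the functional at the
  corresponding unit coefficient array.  The ordering of rows and columns is immaterial for
  nonsingularity.\<close>

definition cbc_matrix :: "nat \<Rightarrow> ((real \<Rightarrow> real \<Rightarrow> real) \<Rightarrow> real \<Rightarrow> real \<Rightarrow> real) \<Rightarrow>
    face \<Rightarrow> bcond \<Rightarrow> real \<Rightarrow> real \<Rightarrow> real \<Rightarrow> real \<Rightarrow> real mat" where
  "cbc_matrix m L fc bc \<Delta>r \<Delta>s ri sj =
     mat (4 * (m+1)^2) (4 * (m+1)^2)
       (\<lambda>(i, j). (cbc_rows m L fc bc \<Delta>r \<Delta>s ri sj ! i) (unit_coeff (cbc_cols m ! j)))"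

lemma length_cbc_rows: "length (cbc_rows m L fc bc \<Delta>r \<Delta>s ri sj) = 4 * (m+1)^2"
  by (cases fc)
     (simp_all add: cbc_rows_def length_concat comp_def sum_list_triv power2_eq_square algebra_simps
        del: upt_Suc)

lemma length_cbc_cols: "length (cbc_cols m) = 4 * (m+1)^2"
  by (simp add: cbc_cols_def power2_eq_square algebra_simps)

end

theory Submission
  imports Defs "Jordan_Normal_Form.Char_Poly"
begin

text \<open>The matrix is nonsingular if the only polynomial on which all its functionals vanish is the zero
  polynomial. Consider a left or right face, scale the coordinates, and write such a polynomial as
  \<open>u\<^sub>0(R) + u\<^sub>1(R) S + u\<^sub>2(R) S\<^sup>2 + \<dots>\<close>, with degrees at most \<open>2 * m + 1\<close> in \<open>R\<close> and in \<open>S\<close>. Let \<open>h = \<plusminus> 1 / 2\<close> be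
  the normal coordinate of the two cell centres.

  The matching conditions say that, for \<open>\<alpha> \<le> m\<close>, the Taylor coefficient of order \<open>\<alpha>\<close> in \<open>R\<close> at \<open>h\<close>,
  a polynomial in \<open>S\<close>, has zeros of order \<open>m + 1\<close> at \<open>S = 1 / 2\<close> and at \<open>S = - 1 / 2\<close>. Its degree is too small
  for that unless it vanishes. Hence every \<open>u\<^sub>k\<close> is divisible by \<open>(R - h)^(m + 1)\<close>
  (\<open>dvd_coeffs_if_matching\<close>).

  The boundary conditions prescribe so many tangential derivatives that the boundary operator applied
  to the \<open>q\<close>-th power of the model operator vanishes along the whole line \<open>R = 0\<close>
  (\<open>cbc_functional_left_right\<close>). Look at the leading coefficient \<open>u\<^sub>k\<close> in \<open>S\<close>. Tangential derivatives lower
  the degree in \<open>S\<close>, so all that remains for \<open>u\<^sub>k\<close> is that \<open>(D\<^sup>2 + \<kappa> D)^q u\<^sub>k\<close>, or its derivative in the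
  Neumann case, vanishes at 0 for \<open>q \<le> m\<close>, where \<open>\<kappa> = c10 * \<Delta>r / c20\<close>
  (\<open>model_op_pow_top_coeff\<close>, \<open>eq_0_if_traces_vanish\<close>). This is a problem in one variable that knows
  the mesh only through \<open>\<kappa>\<close>, so the bound on \<open>\<Delta>r\<close> can be chosen independently of \<open>\<Delta>s\<close>.

  If \<open>\<kappa> = 0\<close>, then \<open>u\<^sub>k\<close> is odd (Dirichlet) or even (Neumann), so it is divisible by \<open>(R + h)^(m + 1)\<close> too, and
  this is impossible for a nonzero polynomial of degree at most \<open>2 * m + 1\<close> (\<open>trace_cond_no_drift\<close>). The
  one-variable problem is a square linear system with entries continuous in \<open>\<kappa>\<close>, so it remains uniquely
  solvable for small \<open>\<bar>\<kappa>\<bar>\<close> (\<open>trace_cond_small_drift\<close>). Bottom and top faces follow by exchanging the two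
  coordinates (\<open>cbc_unisolvent_bottom_top\<close>).\<close>

section \<open>Polynomials with high-order zeros\<close>

text \<open>Two zeros of order \<open>n\<close> at different points need degree at least \<open>2 * n\<close>. This is used
  in both directions: tangentially the two centres lie at \<open>\<plusminus> 1 / 2\<close>, and in the normal direction parity
  reflects the zero at the centres to the opposite side of the boundary.\<close>

lemma eq_0_if_two_roots_fill_degree:
  fixes p :: "real poly"
  assumes "[:- h, 1:] ^ n dvd p" "[:h, 1:] ^ n dvd p" "degree p < 2 * n" "h \<noteq> 0"
  shows "p = 0"
proof (rule ccontr)
  assume p: "p \<noteq> 0"
  obtain q where q: "p = [:- h, 1:] ^ n * q"
    using assms(1) by (rule dvdE)
  have "q \<noteq> 0"
    using p q by auto
  have "order (- h) ([:- h, 1:] ^ n) = 0"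
    using \<open>h \<noteq> 0\<close> by (intro order_0I) simp
  then have "order (- h) p = order (- h) q"
    using p unfolding q by (subst order_mult) auto
  moreover have "n \<le> order (- h) p"
    using assms(2) p order_divides[of "- h" n p] by simp
  moreover have "order (- h) q \<le> degree q"
    using \<open>q \<noteq> 0\<close> by (rule order_degree)
  moreover have "degree p = n + degree q"
    unfolding q using \<open>q \<noteq> 0\<close> by (simp add: degree_mult_eq degree_linear_power)
  ultimately show False
    using assms(3) by linarith
qed

text \<open>Substituting \<open>x + h\<close> for \<open>x\<close> moves the zero to the origin, where its order is read off from the
  coefficients; the coefficients of \<open>p \<circ>\<^sub>p [:h, 1:]\<close> are the Taylor coefficients of \<open>p\<close> at \<open>h\<close>.\<close>

lemma linear_power_dvd_iff_taylor_coeffs: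
  fixes p :: "real poly"
  shows "[:- h, 1:] ^ n dvd p \<longleftrightarrow> (\<forall>i<n. coeff (p \<circ>\<^sub>p [:h, 1:]) i = 0)"
proof -
  have "[:- h, 1:] ^ n dvd p \<longleftrightarrow> monom 1 n dvd p \<circ>\<^sub>p [:h, 1:]"
  proof
    assume "[:- h, 1:] ^ n dvd p"
    then obtain q where "p = [:- h, 1:] ^ n * q"
      by (rule dvdE)
    then have "p \<circ>\<^sub>p [:h, 1:] = monom 1 n * (q \<circ>\<^sub>p [:h, 1:])"
      by (simp add: pcompose_mult pcompose_hom.hom_power pcompose_pCons monom_altdef)
    then show "monom 1 n dvd p \<circ>\<^sub>p [:h, 1:]"
      by simp
  next
    assume "monom 1 n dvd p \<circ>\<^sub>p [:h, 1:]"
    then obtain q where "p \<circ>\<^sub>p [:h, 1:] = monom 1 n * q"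
      by (rule dvdE)
    then have "p \<circ>\<^sub>p [:h, 1:] \<circ>\<^sub>p [:- h, 1:] = [:- h, 1:] ^ n * (q \<circ>\<^sub>p [:- h, 1:])"
      by (simp add: pcompose_mult pcompose_hom.hom_power pcompose_pCons monom_altdef)
    moreover have "p \<circ>\<^sub>p [:h, 1:] \<circ>\<^sub>p [:- h, 1:] = p"
      by (simp add: pcompose_assoc[symmetric] pcompose_pCons)
    ultimately show "[:- h, 1:] ^ n dvd p"
      by simp
  qed
  then show ?thesis
    by (simp add: monom_1_dvd_iff')
qed

lemma coeff_shift_monom:
  fixes h :: real
  shows "coeff (monom 1 l \<circ>\<^sub>p [:h, 1:]) i = real (l choose i) * h ^ (l - i)"
proof -
  have "coeff ([:h, 1:] ^ l) i = real (l choose i) * h ^ (l - i)"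
  proof (induction l arbitrary: i)
    case (Suc l)
    show ?case
    proof (cases i)
      case (Suc j)
      have "h * (real (l choose Suc j) * h ^ (l - Suc j)) = real (l choose Suc j) * h ^ (l - j)"
        by (cases "j < l") (auto simp: Suc_diff_Suc[symmetric] binomial_eq_0)
      then show ?thesis
        using Suc by (simp add: Suc.IH coeff_pCons algebra_simps)
    qed (simp add: Suc.IH)
  qed (simp add: coeff_pCons split: nat.splits)
  then show ?thesis
    by (simp add: monom_altdef pcompose_hom.hom_power pcompose_pCons)
qed

text \<open>The right-hand side has the form in which Taylor coefficients enter the matching functionals.\<close>

lemma taylor_coeff_eq_sum:
  fixes p :: "real poly"
  assumes "degree p \<le> D"
  shows "coeff (p \<circ>\<^sub>p [:h, 1:]) i =
    (\<Sum>l = i..D. real (l choose i) * h ^ (l - i) * coeff p l)"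
proof -
  have "p \<circ>\<^sub>p [:h, 1:] = (\<Sum>l\<le>D. smult (coeff p l) (monom 1 l \<circ>\<^sub>p [:h, 1:]))"
    by (subst poly_as_sum_of_monoms'[OF assms, symmetric])
       (simp add: pcompose_sum smult_monom flip: pcompose_smult)
  then have "coeff (p \<circ>\<^sub>p [:h, 1:]) i = 
     (\<Sum>l\<le>D. real (l choose i) * h ^ (l - i) * coeff p l)"
    by (auto simp: coeff_sum coeff_shift_monom mult_ac intro!: sum.cong)
  also have "\<dots> = (\<Sum>l = i..D. real (l choose i) * h ^ (l - i) * coeff p l)"
    by (intro sum.mono_neutral_cong_right) auto
  finally show ?thesis .
qed

lemma coeff_funpow_pderiv:
  fixes p :: "'a :: {comm_semiring_1, semiring_no_zero_divisors, semiring_char_0} poly"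
  shows "coeff ((pderiv ^^ n) p) k = of_nat (pochhammer (k + 1) n) * coeff p (k + n)"
proof (induction n arbitrary: k)
  case (Suc n)
  then show ?case
    by (simp add: coeff_pderiv pochhammer_rec algebra_simps)
qed simp

section \<open>Square systems and their perturbation\<close>

text \<open>Kernel elements are sequences, so that in the applications they are directly families of unknown
  coefficients.\<close>

lemma det_mat_nonzero_iff:
  fixes a :: "nat \<Rightarrow> nat \<Rightarrow> real"
  shows "det (mat n n (\<lambda>(i, j). a i j)) \<noteq> 0 \<longleftrightarrow>
    (\<forall>v. (\<forall>i<n. (\<Sum>j<n. v j * a i j) = 0) \<longrightarrow> (\<forall>j<n. v j = 0))" (is "det ?A \<noteq> 0 \<longleftrightarrow> ?R")
proof -
  have kernel: "?A *\<^sub>v vec n v = 0\<^sub>v n \<longleftrightarrow> (\<forall>i<n. (\<Sum>j<n. v j * a i j) = 0)" for v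
    by (auto simp: vec_eq_iff scalar_prod_def lessThan_atLeast0 mult.commute)
  have "det ?A = 0 \<longleftrightarrow> (\<exists>v. vec n v \<noteq> 0\<^sub>v n \<and> ?A *\<^sub>v vec n v = 0\<^sub>v n)"
  proof
    assume "det ?A = 0"
    then obtain w where "w \<in> carrier_vec n" "w \<noteq> 0\<^sub>v n" "?A *\<^sub>v w = 0\<^sub>v n"
      using det_0_iff_vec_prod_zero[of ?A n] by auto
    moreover have "w = vec n (\<lambda>j. w $ j)"
      using \<open>w \<in> carrier_vec n\<close> by auto
    ultimately show "\<exists>v. vec n v \<noteq> 0\<^sub>v n \<and> ?A *\<^sub>v vec n v = 0\<^sub>v n"
      by metis
  next
    assume "\<exists>v. vec n v \<noteq> 0\<^sub>v n \<and> ?A *\<^sub>v vec n v = 0\<^sub>v n"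
    then show "det ?A = 0"
      by (subst det_0_iff_vec_prod_zero[of _ n]) (auto intro: vec_carrier)
  qed
  then show ?thesis
    unfolding kernel by (auto simp: vec_eq_iff)
qed

text \<open>The determinant is a polynomial expression in the entries, hence continuous in the parameter.\<close>

lemma det_nonzero_perturb:
  fixes A :: "real \<Rightarrow> real mat"
  assumes carrier: "\<And>x. A x \<in> carrier_mat n n"
    and cont: "\<And>i j. i < n \<Longrightarrow> j < n \<Longrightarrow> isCont (\<lambda>x. A x $$ (i, j)) 0"
    and "det (A 0) \<noteq> 0"
  shows "\<exists>\<delta>>0. \<forall>x. \<bar>x\<bar> < \<delta> \<longrightarrow> det (A x) \<noteq> 0"
proof -
  have "isCont (\<lambda>x. det (A x)) 0"
    unfolding det_def'[OF carrier]
    by (intro continuous_intros cont) (auto dest: permutes_in_image)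
  then have "\<forall>\<^sub>F x in at 0. det (A x) \<noteq> 0"
    using \<open>det (A 0) \<noteq> 0\<close> unfolding isCont_def by (rule tendsto_imp_eventually_ne)
  then obtain \<delta> where "\<delta> > 0" "\<And>x. x \<noteq> 0 \<Longrightarrow> \<bar>x\<bar> < \<delta> \<Longrightarrow> det (A x) \<noteq> 0"
    by (auto simp: eventually_at)
  then show ?thesis
    using \<open>det (A 0) \<noteq> 0\<close> by metis
qed

section \<open>The one-dimensional trace problem\<close>

text \<open>Up to the factor \<open>c20 / \<Delta>r\<^sup>2\<close>, this is the part of the model operator that acts in the normal
  direction only, with \<open>\<kappa> = c10 * \<Delta>r / c20\<close>.\<close>

definition drift_op :: "real \<Rightarrow> real poly \<Rightarrow> real poly" where
  "drift_op \<kappa> p = pderiv (pderiv p) + smult \<kappa> (pderiv p)"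

text \<open>The conditions that the system imposes on the leading coefficient of a kernel element, regarded as
  a polynomial in the tangential variable. Here \<open>h\<close> is the normal coordinate of the cell centres, and
  \<open>\<nu>\<close> is the order of the boundary condition: 0 for Dirichlet and 1 for Neumann.\<close>

definition trace_cond :: "nat \<Rightarrow> real \<Rightarrow> nat \<Rightarrow> real \<Rightarrow> real poly \<Rightarrow> bool" where
  "trace_cond m h \<nu> \<kappa> p \<longleftrightarrow> degree p \<le> 2 * m + 1 \<and> [:- h, 1:] ^ (m + 1) dvd p \<and>
     (\<forall>q\<le>m. coeff ((drift_op \<kappa> ^^ q) p) \<nu> = 0)"

text \<open>Without drift the iterated operator is an even power of the derivative, so the coefficients of \<open>p\<close>
  with the parity of \<open>\<nu>\<close> vanish. Thus \<open>p\<close> is odd (for \<open>\<nu> = 0\<close>) or even (for \<open>\<nu> = 1\<close>), and its zero of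
  order \<open>m + 1\<close> at \<open>h\<close> is reflected to a second one at \<open>- h\<close>; the degree is too small for both.\<close>

lemma trace_cond_no_drift:
  assumes "trace_cond m h \<nu> 0 p" "h \<noteq> 0" "\<nu> \<le> 1"
  shows "p = 0"
proof -
  have pow: "drift_op 0 ^^ q = pderiv ^^ (2 * q)" for q
    by (induction q) (auto simp: drift_op_def fun_eq_iff)
  have vanish: "coeff p (2 * q + \<nu>) = 0" for q
  proof (cases "q \<le> m")
    case True
    then have "coeff ((pderiv ^^ (2 * q)) p) \<nu> = 0"
      using assms(1) by (auto simp: trace_cond_def pow)
    then show ?thesis
      using pochhammer_pos[of "Suc \<nu>" "2 * q"] by (simp add: coeff_funpow_pderiv add.commute)
  next
    case False
    then show ?thesis
      using assms(1) by (intro coeff_eq_0) (auto simp: trace_cond_def)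
  qed
  have "(- 1) ^ i * coeff p i = (- 1) ^ (\<nu> + 1) * coeff p i" for i
  proof (cases "even i = even \<nu>")
    case True
    then have "\<nu> \<le> i"
      using \<open>\<nu> \<le> 1\<close> by (cases i) (auto simp: le_Suc_eq)
    then obtain q where "i = 2 * q + \<nu>"
      using True by (metis add.commute dvdE even_diff_nat le_add_diff_inverse2 even_add)
    then show ?thesis
      by (simp add: vanish)
  qed auto
  then have reflect: "p \<circ>\<^sub>p [:0, - 1:] = smult ((- 1) ^ (\<nu> + 1)) p"
    by (simp add: poly_eq_iff coeff_pcompose_linear)
  \<comment> \<open>The reflection carries the factor \<open>x - h\<close> to \<open>- (x + h)\<close>.\<close>
  obtain q where "p = [:- h, 1:] ^ (m + 1) * q"
    using assms(1) by (auto simp: trace_cond_def elim!: dvdE)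
  then have "p \<circ>\<^sub>p [:0, - 1:] = [:- h, - 1:] ^ (m + 1) * (q \<circ>\<^sub>p [:0, - 1:])"
    by (simp add: pcompose_mult pcompose_hom.hom_power pcompose_pCons del: power_Suc)
  also have "[:- h, - 1:] = - [:h, 1:]"
    by simp
  finally have "p \<circ>\<^sub>p [:0, - 1:] = [:h, 1:] ^ (m + 1) * ((- 1) ^ (m + 1) * (q \<circ>\<^sub>p [:0, - 1:]))"
    by (simp only: power_minus[of "[:h, 1:]"] mult_ac)
  then have "[:h, 1:] ^ (m + 1) dvd p \<circ>\<^sub>p [:0, - 1:]"
    by (rule dvdI)
  then have "[:h, 1:] ^ (m + 1) dvd p"
    unfolding reflect by (simp add: dvd_smult_iff del: power_Suc)
  then show ?thesis
    using assms by (intro eq_0_if_two_roots_fill_degree[of h "m + 1"]) (auto simp: trace_cond_def)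
qed

lemma coeff_drift_op: "coeff (drift_op \<kappa> p) i =
   of_nat ((i + 1) * (i + 2)) * coeff p (i + 2) + \<kappa> * of_nat (i + 1) * coeff p (i + 1)"
  by (simp add: drift_op_def coeff_pderiv algebra_simps)

lemma isCont_coeff_drift_pow: "isCont (\<lambda>\<kappa>. coeff ((drift_op \<kappa> ^^ q) p) i) x"
proof (induction q arbitrary: i)
  case (Suc q)
  show ?case
    unfolding funpow.simps comp_def coeff_drift_op by (intro continuous_intros Suc.IH)
qed simp

lemma coeff_drift_pow_sum:
  "coeff ((drift_op \<kappa> ^^ q) (\<Sum>l\<in>I. smult (v l) (p l))) i =
     (\<Sum>l\<in>I. v l * coeff ((drift_op \<kappa> ^^ q) (p l)) i)"
  by (induction q arbitrary: i)
     (simp_all add: coeff_sum coeff_drift_op sum_distrib_left sum.distrib algebra_simps)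

text \<open>The conditions form a square linear system of size \<open>2 * m + 2\<close> for the coefficients of \<open>p\<close>, whose
  entries are continuous in \<open>\<kappa>\<close> and whose determinant is nonzero at \<open>\<kappa> = 0\<close>.\<close>

lemma trace_cond_small_drift:
  assumes "h \<noteq> 0" "\<nu> \<le> 1"
  shows "\<exists>\<delta>>0. \<forall>\<kappa>. \<bar>\<kappa>\<bar> < \<delta> \<longrightarrow> (\<forall>p. trace_cond m h \<nu> \<kappa> p \<longrightarrow> p = 0)"
proof -
  define n where "n = 2 * m + 2"
  \<comment> \<open>Rows up to \<open>m\<close>: the zero of order \<open>m + 1\<close> at \<open>h\<close>; the other \<open>m + 1\<close> rows: the traces for \<open>q \<le> m\<close>.\<close>
  define \<phi> where "\<phi> \<kappa> i p = (if i < m + 1 then coeff (p \<circ>\<^sub>p [:h, 1:]) i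
    else coeff ((drift_op \<kappa> ^^ (i - (m + 1))) p) \<nu>)" for \<kappa> i p
  define A where "A \<kappa> = mat n n (\<lambda>(i, l). \<phi> \<kappa> i (monom 1 l))" for \<kappa>
  have linear: "\<phi> \<kappa> i (\<Sum>l<n. monom (v l) l) = (\<Sum>l<n. v l * \<phi> \<kappa> i (monom 1 l))" for \<kappa> i v
  proof -
    have "(\<Sum>l<n. monom (v l) l) = (\<Sum>l<n. smult (v l) (monom 1 l))"
      by (simp add: smult_monom)
    then show ?thesis
      by (simp add: \<phi>_def coeff_drift_pow_sum pcompose_sum pcompose_smult coeff_sum)
  qed
  have conds: "(\<forall>i<n. \<phi> \<kappa> i p = 0) \<longleftrightarrow> trace_cond m h \<nu> \<kappa> p" if "degree p < n" for \<kappa> p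
  proof -
    have "(\<forall>i<n. \<phi> \<kappa> i p = 0) \<longleftrightarrow>
      (\<forall>i<m+1. coeff (p \<circ>\<^sub>p [:h, 1:]) i = 0) \<and> (\<forall>q\<le>m. coeff ((drift_op \<kappa> ^^ q) p) \<nu> = 0)"
    proof (intro iffI conjI allI impI)
      fix q assume "\<forall>i<n. \<phi> \<kappa> i p = 0" "q \<le> m"
      then have "\<phi> \<kappa> (m + 1 + q) p = 0"
        by (simp add: n_def)
      then show "coeff ((drift_op \<kappa> ^^ q) p) \<nu> = 0"
        by (simp add: \<phi>_def)
    next
      fix i assume "\<forall>i<n. \<phi> \<kappa> i p = 0" "i < m + 1"
      then have "\<phi> \<kappa> i p = 0"
        by (simp add: n_def)
      with \<open>i < m + 1\<close> show "coeff (p \<circ>\<^sub>p [:h, 1:]) i = 0"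
        by (simp add: \<phi>_def)
    next
      fix i
      assume "(\<forall>i<m+1. coeff (p \<circ>\<^sub>p [:h, 1:]) i = 0) \<and>
        (\<forall>q\<le>m. coeff ((drift_op \<kappa> ^^ q) p) \<nu> = 0)" "i < n"
      moreover from \<open>i < n\<close> have "i - (m + 1) \<le> m"
        by (simp add: n_def)
      ultimately show "\<phi> \<kappa> i p = 0"
        by (simp add: \<phi>_def)
    qed
    then show ?thesis
      using that unfolding trace_cond_def linear_power_dvd_iff_taylor_coeffs by (auto simp: n_def)
  qed
  have det_iff: "det (A \<kappa>) \<noteq> 0 \<longleftrightarrow> (\<forall>p. trace_cond m h \<nu> \<kappa> p \<longrightarrow> p = 0)" for \<kappa>
  proof -
    have deg: "degree (\<Sum>l<n. monom (v l) l) < n" for v :: "nat \<Rightarrow> real"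
      by (intro degree_sum_less) (auto simp: n_def intro: le_less_trans[OF degree_monom_le])
    have co: "coeff (\<Sum>l<n. monom (v l) l) j = v j" if "j < n" for v :: "nat \<Rightarrow> real" and j
      using that by (simp add: coeff_sum)
    have "det (A \<kappa>) \<noteq> 0 \<longleftrightarrow>
        (\<forall>v. trace_cond m h \<nu> \<kappa> (\<Sum>l<n. monom (v l) l) \<longrightarrow> (\<forall>l<n. v l = 0))"
      unfolding A_def det_mat_nonzero_iff by (simp only: linear[symmetric] conds[OF deg])
    also have "\<dots> \<longleftrightarrow> (\<forall>p. trace_cond m h \<nu> \<kappa> p \<longrightarrow> p = 0)"
    proof (intro iffI allI impI)
      fix p
      assume *: "\<forall>v. trace_cond m h \<nu> \<kappa> (\<Sum>l<n. monom (v l) l) \<longrightarrow> (\<forall>l<n. v l = 0)"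
        and p: "trace_cond m h \<nu> \<kappa> p"
      have "(\<Sum>l<n. monom (coeff p l) l) = p"
        using poly_as_sum_of_monoms'[of p "2 * m + 1"] p
        by (simp add: n_def trace_cond_def lessThan_Suc_atMost)
      then have "\<forall>l<n. coeff p l = 0"
        using * p by metis
      then show "p = 0"
        using \<open>(\<Sum>l<n. monom (coeff p l) l) = p\<close> by (metis (no_types, lifting) lessThan_iff monom_eq_0 sum.neutral)
    next
      fix v l
      assume "\<forall>p. trace_cond m h \<nu> \<kappa> p \<longrightarrow> p = 0"
        "trace_cond m h \<nu> \<kappa> (\<Sum>l<n. monom (v l) l)" "l < n"
      then show "v l = 0"
        by (metis co coeff_0)
    qed
    finally show ?thesis .
  qed
  have "\<exists>\<delta>>0. \<forall>\<kappa>. \<bar>\<kappa>\<bar> < \<delta> \<longrightarrow> det (A \<kappa>) \<noteq> 0"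
  proof (rule det_nonzero_perturb)
    show "A \<kappa> \<in> carrier_mat n n" for \<kappa>
      by (simp add: A_def)
    show "isCont (\<lambda>\<kappa>. A \<kappa> $$ (i, l)) 0" if "i < n" "l < n" for i l
      using that by (cases "i < m + 1") (simp_all add: A_def \<phi>_def isCont_coeff_drift_pow)
    show "det (A 0) \<noteq> 0"
      using trace_cond_no_drift[OF _ assms] by (simp add: det_iff)
  qed
  then show ?thesis
    by (simp only: det_iff)
qed

section \<open>Constant-coefficient operators on bivariate polynomials\<close>

text \<open>A bivariate polynomial is a polynomial in the tangential variable whose coefficients are
  polynomials in the normal variable. The tangential derivative is then \<open>pderiv\<close>, and the
  leading coefficient that drives the proof is the coefficient at \<open>degree Q\<close>.\<close>

definition normal_deriv :: "real poly poly \<Rightarrow> real poly poly" where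
  "normal_deriv = map_poly pderiv"

definition model_op :: "real \<Rightarrow> real \<Rightarrow> real \<Rightarrow> real \<Rightarrow> real \<Rightarrow> real poly poly \<Rightarrow> real poly poly" where
  "model_op a b c d e Q =
     smult [:a:] (normal_deriv (normal_deriv Q)) + smult [:2 * b:] (normal_deriv (pderiv Q))
     + smult [:c:] (pderiv (pderiv Q)) + smult [:d:] (normal_deriv Q) + smult [:e:] (pderiv Q)"

fun bc_poly :: "bcond \<Rightarrow> real poly poly \<Rightarrow> real poly poly" where
  "bc_poly Dirichlet Q = Q"
| "bc_poly (Neumann b1 b2) Q = smult [:b1:] (normal_deriv Q) + smult [:b2:] (pderiv Q)"

fun bc_order :: "bcond \<Rightarrow> nat" where
  "bc_order Dirichlet = 0"
| "bc_order (Neumann b1 b2) = 1"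

lemma coeff_normal_deriv: "coeff (normal_deriv Q) k = pderiv (coeff Q k)"
  by (simp add: normal_deriv_def coeff_map_poly)

lemma normal_deriv_smult_const: "normal_deriv (smult [:c:] Q) = smult [:c:] (normal_deriv Q)"
  by (simp add: poly_eq_iff coeff_normal_deriv pderiv_smult)

lemma normal_deriv_pderiv: "normal_deriv (pderiv Q) = pderiv (normal_deriv Q)"
proof (rule poly_eqI)
  fix k
  have "pderiv (of_nat (Suc k) * p) = of_nat (Suc k) * pderiv p" for p :: "real poly"
    by (simp add: of_nat_poly pderiv_smult del: of_nat_Suc)
  then show "coeff (normal_deriv (pderiv Q)) k = coeff (pderiv (normal_deriv Q)) k"
    by (simp add: coeff_normal_deriv coeff_pderiv del: of_nat_Suc)
qed

lemma drift_op_smult: "drift_op \<kappa> (smult c p) = smult c (drift_op \<kappa> p)"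
  by (simp add: drift_op_def pderiv_smult smult_add_right mult.commute)

lemma drift_pow_smult: "(drift_op \<kappa> ^^ q) (smult c p) = smult c ((drift_op \<kappa> ^^ q) p)"
  by (induction q) (simp_all add: drift_op_smult)

text \<open>Every tangential derivative lowers the tangential degree, so only the pure normal part of the
  operator reaches the leading coefficient: the mixed, tangential and first-order tangential terms
  drop out.\<close>

lemma model_op_pow_top_coeff:
  assumes "a \<noteq> 0" "\<And>j. j > k \<Longrightarrow> coeff Q j = 0"
  shows "(\<forall>j>k. coeff ((model_op a b c d e ^^ q) Q) j = 0) \<and>
    coeff ((model_op a b c d e ^^ q) Q) k = smult (a ^ q) ((drift_op (d / a) ^^ q) (coeff Q k))"
proof (induction q)
  case (Suc q)
  then show ?case
    using \<open>a \<noteq> 0\<close>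
    by (simp add: model_op_def coeff_normal_deriv coeff_pderiv pderiv_smult drift_op_def
        smult_add_right mult_ac)
qed (use assms(2) in simp)

lemma bc_poly_top_coeff:
  assumes "\<forall>j>k. coeff Q j = 0"
  shows "coeff (coeff (bc_poly bc Q) k) 0 =
    (case bc of Dirichlet \<Rightarrow> 1 | Neumann b1 b2 \<Rightarrow> b1) * coeff (coeff Q k) (bc_order bc)"
  using assms by (cases bc) (simp_all add: coeff_normal_deriv coeff_pderiv)

text \<open>If \<open>Q\<close> were nonzero, its leading coefficient would be a nonzero polynomial that satisfies the
  one-dimensional trace conditions.\<close>

lemma eq_0_if_traces_vanish:
  assumes "a \<noteq> 0" "admissible_bc LeftFace bc"
    and unisolvent: "\<And>p. trace_cond m h (bc_order bc) (d / a) p \<Longrightarrow> p = 0"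
    and degrees: "degree Q \<le> 2 * m + 1" "\<And>k. degree (coeff Q k) \<le> 2 * m + 1"
    and matching: "\<And>k. [:- h, 1:] ^ (m + 1) dvd coeff Q k"
    and traces: "\<And>q k. q \<le> m \<Longrightarrow> k \<le> 2 * m + 1 \<Longrightarrow>
        coeff (coeff (bc_poly bc ((model_op a b c d e ^^ q) Q)) k) 0 = 0"
  shows "Q = 0"
proof -
  define k where "k = degree Q"
  have above: "coeff Q j = 0" if "j > k" for j
    using that by (simp add: k_def coeff_eq_0)
  have "coeff ((drift_op (d / a) ^^ q) (coeff Q k)) (bc_order bc) = 0" if "q \<le> m" for q
  proof -
    note top = model_op_pow_top_coeff[OF \<open>a \<noteq> 0\<close> above, where q = q and b = b and c = c and d = d and e = e]
    show ?thesis
      using traces[OF that, of k] degrees(1) bc_poly_top_coeff[OF top[THEN conjunct1], where bc = bc] top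
        assms(1,2)
      by (cases bc) (auto simp: k_def)
  qed
  then have "trace_cond m h (bc_order bc) (d / a) (coeff Q k)"
    using degrees matching by (auto simp: trace_cond_def)
  then show ?thesis
    using unisolvent by (fastforce simp: k_def)
qed

section \<open>The matching conditions\<close>

definition bivariate :: "nat \<Rightarrow> (nat \<Rightarrow> nat \<Rightarrow> real) \<Rightarrow> real poly poly" where
  "bivariate D U = (\<Sum>k\<le>D. monom (\<Sum>l\<le>D. monom (U l k) l) k)"

lemma coeff_bivariate: "coeff (bivariate D U) k = (if k \<le> D then \<Sum>l\<le>D. monom (U l k) l else 0)"
  by (simp add: bivariate_def coeff_sum)

lemma coeff_coeff_bivariate:
  "coeff (coeff (bivariate D U) k) l = (if k \<le> D \<and> l \<le> D then U l k else 0)"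
  by (simp add: coeff_bivariate coeff_sum)

lemma degree_bivariate: "degree (bivariate D U) \<le> D" "degree (coeff (bivariate D U) k) \<le> D"
  by (intro degree_le allI impI; simp add: coeff_bivariate)
     (intro degree_le allI impI; simp add: coeff_coeff_bivariate)

text \<open>Taylor expansion in the two variables can be done one variable after the other: first in the
  normal one at \<open>\<sigma> / 2\<close>, which leaves a polynomial in the tangential one.\<close>

lemma matching_functional_eq_taylor_coeff:
  "matching_functional m (\<sigma>, \<tau>) \<alpha> \<beta> U =
     coeff ((\<Sum>k\<le>2*m+1. monom (coeff (coeff (bivariate (2*m+1) U) k \<circ>\<^sub>p [:\<sigma> / 2, 1:]) \<alpha>) k)
       \<circ>\<^sub>p [:\<tau> / 2, 1:]) \<beta>"
  (is "_ = coeff (?w \<circ>\<^sub>p _) _")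
proof -
  let ?D = "2 * m + 1"
  have deg: "degree ?w \<le> ?D"
    by (intro degree_sum_le) (auto intro: order.trans[OF degree_monom_le])
  have coeff_w: "coeff ?w k = (\<Sum>l=\<alpha>..?D. real (l choose \<alpha>) * (\<sigma> / 2) ^ (l - \<alpha>) * U l k)"
    if "k \<le> ?D" for k
  proof -
    have "coeff ?w k = coeff (coeff (bivariate ?D U) k \<circ>\<^sub>p [:\<sigma> / 2, 1:]) \<alpha>"
      using that by (simp add: coeff_sum)
    also have "\<dots> = (\<Sum>l=\<alpha>..?D. real (l choose \<alpha>) * (\<sigma> / 2) ^ (l - \<alpha>) * U l k)"
      using that by (subst taylor_coeff_eq_sum[OF degree_bivariate(2)])
        (auto simp: coeff_coeff_bivariate intro!: sum.cong)
    finally show ?thesis .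
  qed
  have "coeff (?w \<circ>\<^sub>p [:\<tau> / 2, 1:]) \<beta> = (\<Sum>k=\<beta>..?D. real (k choose \<beta>) * (\<tau> / 2) ^ (k - \<beta>) * coeff ?w k)"
    by (rule taylor_coeff_eq_sum[OF deg])
  also have "\<dots> = (\<Sum>k=\<beta>..?D. \<Sum>l=\<alpha>..?D. real (k choose \<beta>) * (\<tau> / 2) ^ (k - \<beta>) * 
      (real (l choose \<alpha>) * (\<sigma> / 2) ^ (l - \<alpha>) * U l k))"
    by (intro sum.cong refl) (simp only: coeff_w atLeastAtMost_iff sum_distrib_left)
  also have "\<dots> = matching_functional m (\<sigma>, \<tau>) \<alpha> \<beta> U"
    unfolding matching_functional_def by (subst sum.swap) (simp add: mult_ac del: sum.cl_ivl_Suc)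
  finally show ?thesis
    by simp
qed

text \<open>For \<open>\<alpha> \<le> m\<close>, the normal Taylor coefficient of order \<open>\<alpha>\<close> is a polynomial in the tangential
  variable, of degree at most \<open>2 * m + 1\<close>, with zeros of order \<open>m + 1\<close> at both tangential positions
  \<open>\<plusminus> 1 / 2\<close> of the centres; so it vanishes identically, which is a statement about each
  coefficient separately.\<close>

lemma dvd_coeffs_if_matching:
  assumes "\<And>\<tau> \<alpha> \<beta>. \<tau> \<in> {1, -1} \<Longrightarrow> \<alpha> \<le> m \<Longrightarrow> \<beta> \<le> m \<Longrightarrow> matching_functional m (\<sigma>, \<tau>) \<alpha> \<beta> U = 0"
  shows "[:- (\<sigma> / 2), 1:] ^ (m + 1) dvd coeff (bivariate (2*m+1) U) k"
  unfolding linear_power_dvd_iff_taylor_coeffs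
proof (intro allI impI)
  fix \<alpha> assume "\<alpha> < m + 1"
  define w where "w = (\<Sum>k\<le>2*m+1. monom (coeff (coeff (bivariate (2*m+1) U) k \<circ>\<^sub>p [:\<sigma> / 2, 1:]) \<alpha>) k)"
  have dvd: "[:- (\<tau> / 2), 1:] ^ (m + 1) dvd w" if "\<tau> \<in> {1, -1}" for \<tau>
    unfolding linear_power_dvd_iff_taylor_coeffs
    using assms[OF that] \<open>\<alpha> < m + 1\<close>
    by (simp add: w_def matching_functional_eq_taylor_coeff del: sum.atMost_Suc)
  have "degree w < 2 * (m + 1)"
    unfolding w_def by (intro degree_sum_less) (auto intro: le_less_trans[OF degree_monom_le])
  then have "w = 0"
    using dvd[of 1] dvd[of "-1"] by (intro eq_0_if_two_roots_fill_degree[of "1 / 2" "m + 1"]) auto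
  then have "coeff w k = 0"
    by simp
  then show "coeff (coeff (bivariate (2*m+1) U) k \<circ>\<^sub>p [:\<sigma> / 2, 1:]) \<alpha> = 0"
    by (cases "k \<le> 2 * m + 1") (simp_all add: w_def coeff_sum coeff_bivariate del: sum.atMost_Suc)
qed

section \<open>The boundary conditions\<close>

text \<open>The function of \<open>(r, s)\<close> that \<open>Q\<close> represents, with normal direction \<open>r\<close> and tangential direction
  \<open>s\<close>, in coordinates centred at the boundary point and scaled by the mesh.\<close>

definition surface :: "real \<Rightarrow> real \<Rightarrow> real \<Rightarrow> real \<Rightarrow> real poly poly \<Rightarrow> real \<Rightarrow> real \<Rightarrow> real" where
  "surface \<Delta>r \<Delta>s ri sj Q r s = poly (poly Q [:(s - sj) / \<Delta>s:]) ((r - ri) / \<Delta>r)"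

lemma poly_normal_deriv: "poly (normal_deriv Q) [:y:] = pderiv (poly Q [:y:])"
  by (induction Q) (simp_all add: normal_deriv_def map_poly_pCons pderiv_add pderiv_smult pderiv_mult pderiv_pCons)

lemma has_derivative_poly_poly:
  "((\<lambda>y. poly (poly Q [:y:]) x) has_real_derivative poly (poly (pderiv Q) [:y:]) x) (at y)"
  for Q :: "real poly poly"
proof (induction Q)
  case (pCons p Q)
  show ?case
    by (auto intro!: derivative_eq_intros pCons.IH simp: pderiv_pCons)
qed simp

lemma pd_r_surface: "pd_r (surface \<Delta>r \<Delta>s ri sj Q) = surface \<Delta>r \<Delta>s ri sj (smult [:1 / \<Delta>r:] (normal_deriv Q))"
proof (intro ext)
  fix r s
  have "((\<lambda>x. poly P ((x - ri) / \<Delta>r)) has_real_derivative poly (pderiv P) ((r - ri) / \<Delta>r) * (1 / \<Delta>r)) (at r)" for P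
    by (rule DERIV_chain2[OF poly_DERIV DERIV_cdivide]) (auto intro!: derivative_eq_intros)
  then show "pd_r (surface \<Delta>r \<Delta>s ri sj Q) r s = surface \<Delta>r \<Delta>s ri sj (smult [:1 / \<Delta>r:] (normal_deriv Q)) r s"
    unfolding pd_r_def surface_def by (subst DERIV_imp_deriv) (auto simp: poly_normal_deriv)
qed

lemma pd_s_surface: "pd_s (surface \<Delta>r \<Delta>s ri sj Q) = surface \<Delta>r \<Delta>s ri sj (smult [:1 / \<Delta>s:] (pderiv Q))"
proof (intro ext)
  fix r s
  have "((\<lambda>y. poly (poly Q [:(y - sj) / \<Delta>s:]) x) has_real_derivative
      poly (poly (pderiv Q) [:(s - sj) / \<Delta>s:]) x * (1 / \<Delta>s)) (at s)" for x
    by (rule DERIV_chain2[OF has_derivative_poly_poly DERIV_cdivide]) (auto intro!: derivative_eq_intros)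
  then show "pd_s (surface \<Delta>r \<Delta>s ri sj Q) r s = surface \<Delta>r \<Delta>s ri sj (smult [:1 / \<Delta>s:] (pderiv Q)) r s"
    unfolding pd_s_def surface_def by (subst DERIV_imp_deriv) auto
qed

lemma pd_s_pd_r_surface:
  "pd_s (pd_r (surface \<Delta>r \<Delta>s ri sj Q)) = pd_r (pd_s (surface \<Delta>r \<Delta>s ri sj Q))"
  by (simp add: pd_r_surface pd_s_surface normal_deriv_smult_const pderiv_smult pderiv_pCons
      normal_deriv_pderiv mult_ac)

text \<open>The chain rule turns the coefficients of the normal derivative into these ones in scaled
  coordinates.\<close>

fun scale_bc :: "real \<Rightarrow> real \<Rightarrow> bcond \<Rightarrow> bcond" where
  "scale_bc \<Delta>r \<Delta>s Dirichlet = Dirichlet"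
| "scale_bc \<Delta>r \<Delta>s (Neumann b1 b2) = Neumann (b1 / \<Delta>r) (b2 / \<Delta>s)"

lemma L0_surface:
  "L0 c20 c11 c02 c10 c01 (surface \<Delta>r \<Delta>s ri sj Q) = surface \<Delta>r \<Delta>s ri sj
    (model_op (c20 / \<Delta>r\<^sup>2) (c11 / (\<Delta>r * \<Delta>s)) (c02 / \<Delta>s\<^sup>2) (c10 / \<Delta>r) (c01 / \<Delta>s) Q)"
  unfolding L0_def[abs_def] pd_r_surface pd_s_surface
  by (intro ext) (simp add: surface_def model_op_def normal_deriv_smult_const pderiv_smult
      pderiv_pCons power2_eq_square)

lemma L0_pow_surface:
  "(L0 c20 c11 c02 c10 c01 ^^ q) (surface \<Delta>r \<Delta>s ri sj Q) = surface \<Delta>r \<Delta>s ri sj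
    ((model_op (c20 / \<Delta>r\<^sup>2) (c11 / (\<Delta>r * \<Delta>s)) (c02 / \<Delta>s\<^sup>2) (c10 / \<Delta>r) (c01 / \<Delta>s) ^^ q) Q)"
  by (induction q) (simp_all add: L0_surface)

lemma bc_op_surface:
  "bc_op bc (surface \<Delta>r \<Delta>s ri sj Q) = surface \<Delta>r \<Delta>s ri sj (bc_poly (scale_bc \<Delta>r \<Delta>s bc) Q)"
  by (intro ext, cases bc) (simp_all add: pd_r_surface pd_s_surface, simp_all add: surface_def)

lemma pd_s_pow_surface_at_center:
  "(pd_s ^^ \<alpha>) (surface \<Delta>r \<Delta>s ri sj Q) ri sj = fact \<alpha> / \<Delta>s ^ \<alpha> * coeff (coeff Q \<alpha>) 0"
proof -
  have "(pd_s ^^ \<alpha>) (surface \<Delta>r \<Delta>s ri sj Q) =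
      surface \<Delta>r \<Delta>s ri sj (smult [:(1 / \<Delta>s) ^ \<alpha>:] ((pderiv ^^ \<alpha>) Q))"
    by (induction \<alpha>) (simp_all add: pd_s_surface pderiv_smult pderiv_pCons one_pCons[symmetric])
  moreover have "real (pochhammer (Suc 0) \<alpha>) = fact \<alpha>"
    by (metis One_nat_def of_nat_fact pochhammer_fact)
  ultimately show ?thesis
    by (simp add: surface_def poly_0_coeff_0 coeff_funpow_pderiv of_nat_poly power_one_over)
qed

lemma ubar_eq_surface: "ubar m \<Delta>r \<Delta>s ri sj U = surface \<Delta>r \<Delta>s ri sj (bivariate (2*m+1) U)"
proof (intro ext)
  fix r s
  have "ubar m \<Delta>r \<Delta>s ri sj U r s = (\<Sum>k\<le>2*m+1. \<Sum>l\<le>2*m+1. U l k * ((r - ri) / \<Delta>r) ^ l * ((s - sj) / \<Delta>s) ^ k)"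
    unfolding ubar_def atLeast0AtMost by (rule sum.swap)
  also have "\<dots> = surface \<Delta>r \<Delta>s ri sj (bivariate (2*m+1) U) r s"
    by (simp add: surface_def bivariate_def poly_sum poly_monom sum_distrib_left poly_const_pow mult_ac
        del: sum.atMost_Suc)
  finally show "ubar m \<Delta>r \<Delta>s ri sj U r s = surface \<Delta>r \<Delta>s ri sj (bivariate (2*m+1) U) r s" .
qed

text \<open>The tangential derivatives of order \<open>\<alpha> \<le> 2 * m + 1\<close> at the boundary point are, up to nonzero factors,
  the coefficients of the trace on the boundary. Together they say that the whole trace vanishes.\<close>

lemma cbc_functional_left_right:
  assumes "fc \<in> {LeftFace, RightFace}"
  shows "cbc_functional m (L0 c20 c11 c02 c10 c01) fc bc \<Delta>r \<Delta>s ri sj q \<alpha> U = fact \<alpha> / \<Delta>s ^ \<alpha> *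
    coeff (coeff (bc_poly (scale_bc \<Delta>r \<Delta>s bc)
      ((model_op (c20 / \<Delta>r\<^sup>2) (c11 / (\<Delta>r * \<Delta>s)) (c02 / \<Delta>s\<^sup>2) (c10 / \<Delta>r) (c01 / \<Delta>s) ^^ q)
        (bivariate (2*m+1) U))) \<alpha>) 0"
proof -
  have "tangential fc = pd_s"
    using assms by auto
  then show ?thesis
    by (simp only: cbc_functional_def ubar_eq_surface L0_pow_surface bc_op_surface
        pd_s_pow_surface_at_center)
qed

section \<open>Nonsingularity as unique solvability\<close>

definition linear_functional :: "((nat \<Rightarrow> nat \<Rightarrow> real) \<Rightarrow> real) \<Rightarrow> bool" where
  "linear_functional F \<longleftrightarrow>
    (\<forall>n v E. F (\<lambda>l k. \<Sum>j<n. v j * E j l k) = (\<Sum>j<(n::nat). v j * F (E j)))"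

text \<open>The matrix records the functionals only on unit arrays. Linearity is what makes its kernel the
  common kernel of the functionals, so it is part of the notion.\<close>

definition cbc_unisolvent :: "nat \<Rightarrow> ((real \<Rightarrow> real \<Rightarrow> real) \<Rightarrow> real \<Rightarrow> real \<Rightarrow> real) \<Rightarrow>
    face \<Rightarrow> bcond \<Rightarrow> real \<Rightarrow> real \<Rightarrow> real \<Rightarrow> real \<Rightarrow> bool" where
  "cbc_unisolvent m L fc bc \<Delta>r \<Delta>s ri sj \<longleftrightarrow>
    (\<forall>F \<in> set (cbc_rows m L fc bc \<Delta>r \<Delta>s ri sj). linear_functional F) \<and>
    (\<forall>U. (\<forall>F \<in> set (cbc_rows m L fc bc \<Delta>r \<Delta>s ri sj). F U = 0) \<longrightarrow>
      (\<forall>l\<le>2*m+1. \<forall>k\<le>2*m+1. U l k = 0))"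

lemma ball_cbc_rows:
  "(\<forall>F \<in> set (cbc_rows m L fc bc \<Delta>r \<Delta>s ri sj). P F) \<longleftrightarrow>
    (\<forall>d \<in> set (centers fc). \<forall>\<alpha>\<le>m. \<forall>\<beta>\<le>m. P (matching_functional m d \<alpha> \<beta>)) \<and>
    (\<forall>q\<le>m. \<forall>\<alpha>\<le>2*m+1. P (cbc_functional m L fc bc \<Delta>r \<Delta>s ri sj q \<alpha>))"
proof -
  have "{0..<m + 1} = {..m}" "{0..<2 * m + 2} = {..2 * m + 1}"
    by auto
  then have "set (cbc_rows m L fc bc \<Delta>r \<Delta>s ri sj) =
    {matching_functional m d \<alpha> \<beta> | d \<alpha> \<beta>. d \<in> set (centers fc) \<and> \<alpha> \<le> m \<and> \<beta> \<le> m} \<union>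
    {cbc_functional m L fc bc \<Delta>r \<Delta>s ri sj q \<alpha> | q \<alpha>. q \<le> m \<and> \<alpha> \<le> 2 * m + 1}"
    by (auto simp: cbc_rows_def simp del: upt_Suc)
  then show ?thesis
    by (simp only:) blast
qed

lemma invertible_mat_if_det_nonzero:
  fixes A :: "'a :: field mat"
  assumes "A \<in> carrier_mat n n" "det A \<noteq> 0"
  shows "invertible_mat A"
  using det_non_zero_imp_unit[OF assms, of n] assms(1)
  by (auto simp: Units_def ring_mat_simps invertible_mat_def inverts_mat_def)

lemma invertible_cbc_matrix:
  assumes "cbc_unisolvent m L fc bc \<Delta>r \<Delta>s ri sj"
  shows "invertible_mat (cbc_matrix m L fc bc \<Delta>r \<Delta>s ri sj)"
proof -
  define n where "n = 4 * (m + 1)\<^sup>2"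
  define rows where "rows = cbc_rows m L fc bc \<Delta>r \<Delta>s ri sj"
  have length_rows: "length rows = n" and length_cols: "length (cbc_cols m) = n"
    by (simp_all only: rows_def n_def length_cbc_rows length_cbc_cols)
  have "det (mat n n (\<lambda>(i, j). (rows ! i) (unit_coeff (cbc_cols m ! j)))) \<noteq> 0"
    unfolding det_mat_nonzero_iff
  proof (intro allI impI)
    fix v :: "nat \<Rightarrow> real" and j
    assume zero: "\<forall>i<n. (\<Sum>j<n. v j * (rows ! i) (unit_coeff (cbc_cols m ! j))) = 0" and "j < n"
    define U where "U l k = (\<Sum>j<n. v j * unit_coeff (cbc_cols m ! j) l k)" for l k
    have "F U = 0" if F: "F \<in> set rows" for F
    proof -
      obtain i where "i < n" "F = rows ! i"
        using F length_rows by (auto simp: in_set_conv_nth)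
      moreover have "linear_functional F"
        using assms F by (simp add: cbc_unisolvent_def rows_def)
      then have "F U = (\<Sum>j<n. v j * F (unit_coeff (cbc_cols m ! j)))"
        using \<open>linear_functional F\<close> by (simp add: linear_functional_def U_def[abs_def])
      ultimately show ?thesis
        using zero by simp
    qed
    then have U: "U l k = 0" if "l \<le> 2*m+1" "k \<le> 2*m+1" for l k
      using assms that by (simp add: cbc_unisolvent_def rows_def)
    obtain l k where lk: "cbc_cols m ! j = (l, k)"
      by fastforce
    have "(l, k) \<in> set (cbc_cols m)"
      using \<open>j < n\<close> length_cols lk by (metis nth_mem)
    then have "U l k = 0"
      by (intro U) (auto simp: cbc_cols_def simp del: upt_Suc)
    have "distinct (cbc_cols m)"
      by (simp add: cbc_cols_def distinct_product del: upt_Suc)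
    then have "unit_coeff (cbc_cols m ! i) l k = (if i = j then 1 else 0)" if "i < n" for i
      using that \<open>j < n\<close> length_cols by (simp add: unit_coeff_def lk[symmetric] nth_eq_iff_index_eq)
    then have "U l k = (\<Sum>i<n. v i * (if i = j then 1 else 0))"
      unfolding U_def by (intro sum.cong) auto
    also have "\<dots> = v j"
      using \<open>j < n\<close> by (simp add: if_distrib[of "\<lambda>x. _ * x"] cong: if_cong)
    finally show "v j = 0"
      using \<open>U l k = 0\<close> by simp
  qed
  then show ?thesis
    unfolding cbc_matrix_def n_def rows_def by (intro invertible_mat_if_det_nonzero) auto
qed

lemma linear_functional_matching: "linear_functional (matching_functional m d \<alpha> \<beta>)"
  unfolding linear_functional_def matching_functional_def
proof (intro allI)
  fix n and v :: "nat \<Rightarrow> real" and E :: "nat \<Rightarrow> nat \<Rightarrow> nat \<Rightarrow> real"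
  let ?w = "\<lambda>l k. real (l choose \<alpha>) * real (k choose \<beta>) * (fst d / 2) ^ (l - \<alpha>) * (snd d / 2) ^ (k - \<beta>)"
  have "(\<Sum>l = \<alpha>..2*m+1. \<Sum>k = \<beta>..2*m+1. ?w l k * (\<Sum>j<n. v j * E j l k)) =
     (\<Sum>l = \<alpha>..2*m+1. \<Sum>k = \<beta>..2*m+1. \<Sum>j<n. v j * (?w l k * E j l k))"
    by (simp only: sum_distrib_left mult_ac)
  also have "\<dots> = (\<Sum>l = \<alpha>..2*m+1. \<Sum>j<n. \<Sum>k = \<beta>..2*m+1. v j * (?w l k * E j l k))"
    by (intro sum.cong refl sum.swap)
  also have "\<dots> = (\<Sum>j<n. \<Sum>l = \<alpha>..2*m+1. \<Sum>k = \<beta>..2*m+1. v j * (?w l k * E j l k))"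
    by (rule sum.swap)
  also have "\<dots> = (\<Sum>j<n. v j * (\<Sum>l = \<alpha>..2*m+1. \<Sum>k = \<beta>..2*m+1. ?w l k * E j l k))"
    by (simp only: sum_distrib_left)
  finally show "(\<Sum>l = \<alpha>..2*m+1. \<Sum>k = \<beta>..2*m+1. ?w l k * (\<Sum>j<n. v j * E j l k)) =
    (\<Sum>j<n. v j * (\<Sum>l = \<alpha>..2*m+1. \<Sum>k = \<beta>..2*m+1. ?w l k * E j l k))" .
qed

lemma bivariate_sum:
  "bivariate D (\<lambda>l k. \<Sum>j<n. v j * E j l k) = (\<Sum>j<n. smult [:v j:] (bivariate D (E j)))"
proof (intro poly_eqI)
  fix k l
  show "coeff (coeff (bivariate D (\<lambda>l k. \<Sum>j<n. v j * E j l k)) k) l =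
    coeff (coeff (\<Sum>j<n. smult [:v j:] (bivariate D (E j))) k) l"
    by (cases "k \<le> D \<and> l \<le> D") (auto simp: coeff_sum coeff_coeff_bivariate)
qed

lemma normal_deriv_sum: "normal_deriv (sum f I) = (\<Sum>j\<in>I. normal_deriv (f j))"
  by (simp add: poly_eq_iff coeff_normal_deriv coeff_sum pderiv_sum)

lemma smult_const_comm: "smult [:c:] (smult [:d:] Q) = smult [:d:] (smult [:c:] Q)"
  for c d :: real
  by (simp add: mult.commute)

text \<open>Scalars appear as constant polynomials \<open>[:v j:]\<close>, so this is linearity over the reals; it fails for
  general coefficients in the normal variable.\<close>

lemma model_op_sum:
  "model_op a b c d e (\<Sum>j\<in>I. smult [:v j:] (Q j)) = (\<Sum>j\<in>I. smult [:v j:] (model_op a b c d e (Q j)))"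
  unfolding model_op_def normal_deriv_sum pderiv_sum normal_deriv_smult_const pderiv_smult
    smult_sum2 smult_add_right
  by (simp only: sum.distrib smult_const_comm)

lemma model_op_pow_sum:
  "(model_op a b c d e ^^ q) (\<Sum>j\<in>I. smult [:v j:] (Q j)) =
     (\<Sum>j\<in>I. smult [:v j:] ((model_op a b c d e ^^ q) (Q j)))"
  by (induction q) (simp_all add: model_op_sum)

lemma bc_poly_sum:
  "bc_poly bc (\<Sum>j\<in>I. smult [:v j:] (Q j)) = (\<Sum>j\<in>I. smult [:v j:] (bc_poly bc (Q j)))"
proof (cases bc)
  case (Neumann b1 b2)
  show ?thesis
    unfolding Neumann bc_poly.simps normal_deriv_sum pderiv_sum normal_deriv_smult_const pderiv_smult
      smult_sum2 smult_add_right
    by (simp only: sum.distrib smult_const_comm)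
qed simp

lemma linear_functional_cbc:
  assumes "fc \<in> {LeftFace, RightFace}"
  shows "linear_functional (cbc_functional m (L0 c20 c11 c02 c10 c01) fc bc \<Delta>r \<Delta>s ri sj q \<alpha>)"
  by (auto simp: linear_functional_def cbc_functional_left_right[OF assms] bivariate_sum
      model_op_pow_sum bc_poly_sum coeff_sum sum_distrib_left mult_ac)

section \<open>Left and right faces\<close>

fun inward_sign :: "face \<Rightarrow> real" where
  "inward_sign LeftFace = 1"
| "inward_sign RightFace = - 1"
| "inward_sign BottomFace = 1"
| "inward_sign TopFace = - 1"

text \<open>In scaled coordinates the ratio of drift to diffusion in the normal direction is
  \<open>(c10 / \<Delta>r) / (c20 / \<Delta>r\<^sup>2) = c10 * \<Delta>r / c20\<close>. It is the only way in which the mesh enters the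
  condition, which therefore does not involve \<open>\<Delta>s\<close>.\<close>

lemma cbc_unisolvent_left_right:
  assumes fc: "fc \<in> {LeftFace, RightFace}" and "admissible_bc fc bc"
    and "c20 \<noteq> 0" "\<Delta>r > 0" "\<Delta>s > 0"
    and unisolvent: "\<And>p. trace_cond m (inward_sign fc / 2) (bc_order bc) (c10 * \<Delta>r / c20) p \<Longrightarrow> p = 0"
  shows "cbc_unisolvent m (L0 c20 c11 c02 c10 c01) fc bc \<Delta>r \<Delta>s ri sj"
  unfolding cbc_unisolvent_def
proof (intro conjI allI impI)
  show "\<forall>F \<in> set (cbc_rows m (L0 c20 c11 c02 c10 c01) fc bc \<Delta>r \<Delta>s ri sj). linear_functional F"
    by (simp add: ball_cbc_rows linear_functional_matching linear_functional_cbc[OF fc])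
next
  fix U and l k :: nat
  assume zero: "\<forall>F \<in> set (cbc_rows m (L0 c20 c11 c02 c10 c01) fc bc \<Delta>r \<Delta>s ri sj). F U = 0"
    and lk: "l \<le> 2 * m + 1" "k \<le> 2 * m + 1"
  define Q where "Q = bivariate (2*m+1) U"
  have centers: "set (centers fc) = {(inward_sign fc, 1), (inward_sign fc, - 1)}"
    using fc by auto
  have "matching_functional m (inward_sign fc, \<tau>) \<alpha> \<beta> U = 0"
    if "\<tau> \<in> {1, - 1}" "\<alpha> \<le> m" "\<beta> \<le> m" for \<tau> \<alpha> \<beta>
    using zero that unfolding ball_cbc_rows centers by blast
  then have dvd: "[:- (inward_sign fc / 2), 1:] ^ (m + 1) dvd coeff Q k" for k
    unfolding Q_def by (rule dvd_coeffs_if_matching)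
  have "Q = 0"
  proof (rule eq_0_if_traces_vanish[OF _ _ _ _ _ dvd])
    show "c20 / \<Delta>r\<^sup>2 \<noteq> 0"
      using assms by simp
    show "admissible_bc LeftFace (scale_bc \<Delta>r \<Delta>s bc)"
      using assms by (cases bc) auto
    have "(c10 / \<Delta>r) / (c20 / \<Delta>r\<^sup>2) = c10 * \<Delta>r / c20"
      using \<open>\<Delta>r > 0\<close> by (simp add: power2_eq_square)
    moreover have "bc_order (scale_bc \<Delta>r \<Delta>s bc) = bc_order bc"
      by (cases bc) auto
    ultimately show "p = 0" if "trace_cond m (inward_sign fc / 2) (bc_order (scale_bc \<Delta>r \<Delta>s bc))
        ((c10 / \<Delta>r) / (c20 / \<Delta>r\<^sup>2)) p" for p
      using that unisolvent by simp
    show "degree Q \<le> 2 * m + 1" "degree (coeff Q k) \<le> 2 * m + 1" for k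
      unfolding Q_def by (rule degree_bivariate)+
    show "coeff (coeff (bc_poly (scale_bc \<Delta>r \<Delta>s bc) ((model_op (c20 / \<Delta>r\<^sup>2) (c11 / (\<Delta>r * \<Delta>s))
        (c02 / \<Delta>s\<^sup>2) (c10 / \<Delta>r) (c01 / \<Delta>s) ^^ q) Q)) \<alpha>) 0 = 0"
      if "q \<le> m" "\<alpha> \<le> 2 * m + 1" for q \<alpha>
    proof -
      have "cbc_functional m (L0 c20 c11 c02 c10 c01) fc bc \<Delta>r \<Delta>s ri sj q \<alpha> U = 0"
        using zero that unfolding ball_cbc_rows by blast
      then show ?thesis
        using \<open>\<Delta>s > 0\<close> by (simp add: cbc_functional_left_right[OF fc] Q_def)
    qed
  qed
  then have "coeff (coeff Q k) l = 0"
    by simp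
  then show "U l k = 0"
    using lk by (simp add: Q_def coeff_coeff_bivariate)
qed

section \<open>Bottom and top faces\<close>

fun swap_bc :: "bcond \<Rightarrow> bcond" where
  "swap_bc Dirichlet = Dirichlet"
| "swap_bc (Neumann b1 b2) = Neumann b2 b1"

fun swap_face :: "face \<Rightarrow> face" where
  "swap_face BottomFace = LeftFace"
| "swap_face TopFace = RightFace"
| "swap_face LeftFace = BottomFace"
| "swap_face RightFace = TopFace"

text \<open>Exchanging the two coordinates maps bottom and top faces to left and right ones; \<open>flip\<close> performs
  it on functions of \<open>(r, s)\<close> and on coefficient arrays alike.\<close>

definition flip :: "('a \<Rightarrow> 'b \<Rightarrow> 'c) \<Rightarrow> 'b \<Rightarrow> 'a \<Rightarrow> 'c" where
  "flip f = (\<lambda>r s. f s r)"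

lemma matching_functional_flip:
  "matching_functional m (\<tau>, \<sigma>) \<beta> \<alpha> U = matching_functional m (\<sigma>, \<tau>) \<alpha> \<beta> (flip U)"
  unfolding matching_functional_def flip_def
  by (subst sum.swap) (simp add: mult_ac del: sum.cl_ivl_Suc)

lemma ubar_flip: "ubar m \<Delta>r \<Delta>s ri sj U = flip (ubar m \<Delta>s \<Delta>r sj ri (flip U))"
  unfolding ubar_def[abs_def] flip_def
  by (intro ext, subst sum.swap) (simp add: mult_ac del: sum.cl_ivl_Suc)

lemma pd_flip: "pd_r (flip f) = flip (pd_s f)" "pd_s (flip f) = flip (pd_r f)"
  by (simp_all add: pd_r_def pd_s_def flip_def fun_eq_iff)

text \<open>The exchange turns the mixed term \<open>\<partial>\<^sub>r \<partial>\<^sub>s\<close> into \<open>\<partial>\<^sub>s \<partial>\<^sub>r\<close>. The two agree on polynomials, which is why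
  this is stated for \<open>surface\<close> and not for arbitrary functions.\<close>

lemma L0_pow_flip_surface:
  "(L0 c20 c11 c02 c10 c01 ^^ q) (flip (surface \<Delta>r \<Delta>s ri sj Q)) =
     flip ((L0 c02 c11 c20 c01 c10 ^^ q) (surface \<Delta>r \<Delta>s ri sj Q))"
proof (induction q)
  case (Suc q)
  have "L0 c20 c11 c02 c10 c01 (flip (surface \<Delta>r \<Delta>s ri sj P)) =
      flip (L0 c02 c11 c20 c01 c10 (surface \<Delta>r \<Delta>s ri sj P))" for P
    by (intro ext) (simp add: L0_def pd_flip pd_s_pd_r_surface, simp add: flip_def L0_def)
  then show ?case
    by (simp add: Suc.IH L0_pow_surface)
qed simp

lemma cbc_functional_flip:
  assumes "fc \<in> {BottomFace, TopFace}"
  shows "cbc_functional m (L0 c20 c11 c02 c10 c01) fc bc \<Delta>r \<Delta>s ri sj q \<alpha> U =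
    cbc_functional m (L0 c02 c11 c20 c01 c10) (swap_face fc) (swap_bc bc) \<Delta>s \<Delta>r sj ri q \<alpha> (flip U)"
proof -
  have pow: "(pd_r ^^ \<alpha>) (flip f) = flip ((pd_s ^^ \<alpha>) f)" for f
    by (induction \<alpha>) (simp_all add: pd_flip)
  have bc: "bc_op bc (flip f) = flip (bc_op (swap_bc bc) f)" for f
    by (intro ext, cases bc) (simp_all add: pd_flip, simp_all add: flip_def)
  have tangential: "tangential fc = pd_r" "tangential (swap_face fc) = pd_s"
    using assms by auto
  have "cbc_functional m (L0 c20 c11 c02 c10 c01) fc bc \<Delta>r \<Delta>s ri sj q \<alpha> U =
    flip ((pd_s ^^ \<alpha>) (bc_op (swap_bc bc) ((L0 c02 c11 c20 c01 c10 ^^ q)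
      (ubar m \<Delta>s \<Delta>r sj ri (flip U))))) ri sj"
    unfolding cbc_functional_def tangential
    by (subst ubar_flip) (simp only: ubar_eq_surface L0_pow_flip_surface bc pow)
  then show ?thesis
    by (simp add: cbc_functional_def tangential flip_def)
qed

lemma cbc_unisolvent_bottom_top:
  assumes fc: "fc \<in> {BottomFace, TopFace}"
    and unisolvent:
      "cbc_unisolvent m (L0 c02 c11 c20 c01 c10) (swap_face fc) (swap_bc bc) \<Delta>s \<Delta>r sj ri"
  shows "cbc_unisolvent m (L0 c20 c11 c02 c10 c01) fc bc \<Delta>r \<Delta>s ri sj"
  unfolding cbc_unisolvent_def
proof (intro conjI allI impI)
  let ?L = "L0 c20 c11 c02 c10 c01" and ?L' = "L0 c02 c11 c20 c01 c10"
  have "linear_functional (cbc_functional m ?L fc bc \<Delta>r \<Delta>s ri sj q \<alpha>)" if "q \<le> m" "\<alpha> \<le> 2 * m + 1" for q \<alpha>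
  proof -
    have "linear_functional (cbc_functional m ?L' (swap_face fc) (swap_bc bc) \<Delta>s \<Delta>r sj ri q \<alpha>)"
      using unisolvent that by (simp add: cbc_unisolvent_def ball_cbc_rows)
    then show ?thesis
      by (simp add: linear_functional_def cbc_functional_flip[OF fc] flip_def)
  qed
  then show "\<forall>F\<in>set (cbc_rows m ?L fc bc \<Delta>r \<Delta>s ri sj). linear_functional F"
    by (simp add: ball_cbc_rows linear_functional_matching)
next
  let ?L = "L0 c20 c11 c02 c10 c01" and ?L' = "L0 c02 c11 c20 c01 c10"
  fix U and l k :: nat
  assume zero: "\<forall>F\<in>set (cbc_rows m ?L fc bc \<Delta>r \<Delta>s ri sj). F U = 0"
    and lk: "l \<le> 2 * m + 1" "k \<le> 2 * m + 1"
  have centers: "set (centers (swap_face fc)) = prod.swap ` set (centers fc)"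
    using fc by auto
  have "matching_functional m (prod.swap d) \<beta> \<alpha> (flip U) = matching_functional m d \<alpha> \<beta> U" for d \<alpha> \<beta>
    using matching_functional_flip[of m "fst d" "snd d" \<alpha> \<beta> U] by (simp add: prod.swap_def)
  then have "\<forall>G\<in>set (cbc_rows m ?L' (swap_face fc) (swap_bc bc) \<Delta>s \<Delta>r sj ri). G (flip U) = 0"
    using zero by (simp add: ball_cbc_rows centers cbc_functional_flip[OF fc])
  then have "flip U k l = 0"
    using unisolvent lk unfolding cbc_unisolvent_def by blast
  then show "U l k = 0"
    by (simp add: flip_def)
qed

section \<open>Nonsingularity of the compatibility matrix\<close>

text \<open>The bound on \<open>\<bar>c10 * \<Delta>r / c20\<bar>\<close> from the one-dimensional problem becomes one on \<open>\<Delta>r\<close>; without normal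
  drift the quantity is 0 for every mesh.\<close>

lemma cbc_unisolvent_small_drift:
  assumes "fc \<in> {LeftFace, RightFace}" "admissible_bc fc bc" "c20 > 0"
  shows "\<exists>\<delta>>0. \<forall>\<Delta>r \<Delta>s ri sj. 0 < \<Delta>r \<and> 0 < \<Delta>s \<and> (\<Delta>r < \<delta> \<or> c10 = 0) \<longrightarrow>
    cbc_unisolvent m (L0 c20 c11 c02 c10 c01) fc bc \<Delta>r \<Delta>s ri sj"
proof -
  have "inward_sign fc / 2 \<noteq> 0" "bc_order bc \<le> 1"
    by (cases fc; simp) (cases bc; simp)
  then obtain \<epsilon> where "\<epsilon> > 0"
    and \<epsilon>: "\<And>\<kappa> p. \<bar>\<kappa>\<bar> < \<epsilon> \<Longrightarrow> trace_cond m (inward_sign fc / 2) (bc_order bc) \<kappa> p \<Longrightarrow> p = 0"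
    using trace_cond_small_drift by metis
  \<comment> \<open>Adding 1 in the denominator also covers \<open>c10 = 0\<close>.\<close>
  define \<delta> where "\<delta> = \<epsilon> * c20 / (\<bar>c10\<bar> + 1)"
  have "\<delta> > 0"
    using \<open>\<epsilon> > 0\<close> \<open>c20 > 0\<close> by (simp add: \<delta>_def)
  moreover have "cbc_unisolvent m (L0 c20 c11 c02 c10 c01) fc bc \<Delta>r \<Delta>s ri sj"
    if "0 < \<Delta>r" "0 < \<Delta>s" "\<Delta>r < \<delta> \<or> c10 = 0" for \<Delta>r \<Delta>s ri sj
  proof (rule cbc_unisolvent_left_right[OF assms(1,2)])
    have "\<bar>c10 * \<Delta>r / c20\<bar> < \<epsilon>"
    proof (cases "c10 = 0")
      case False
      then have "\<Delta>r * (\<bar>c10\<bar> + 1) < \<epsilon> * c20"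
        using that by (simp add: \<delta>_def pos_less_divide_eq)
      then have "\<bar>c10\<bar> * \<Delta>r < \<epsilon> * c20"
        using \<open>0 < \<Delta>r\<close> by (simp add: algebra_simps)
      then show ?thesis
        using \<open>c20 > 0\<close> \<open>0 < \<Delta>r\<close> by (simp add: abs_mult pos_divide_less_eq)
    qed (use \<open>\<epsilon> > 0\<close> in simp)
    then show "p = 0"
      if "trace_cond m (inward_sign fc / 2) (bc_order bc) (c10 * \<Delta>r / c20) p" for p
      using \<epsilon> that by blast
  qed (use that assms in auto)
  ultimately show ?thesis
    by blast
qed

theorem theorem2:
  fixes m :: nat and c20 c11 c02 c10 c01 :: real
  assumes "m \<in> {1, 2, 3, 4}"
  shows
    "(\<forall>fc \<in> {LeftFace, RightFace}. \<forall>bc. admissible_bc fc bc \<longrightarrow> c20 > 0 \<longrightarrow>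
        (\<exists>\<delta>>0. \<forall>\<Delta>r \<Delta>s ri sj. 0 < \<Delta>r \<and> \<Delta>r < \<delta> \<and> 0 < \<Delta>s \<and> noncorner_point fc ri sj \<longrightarrow>
           invertible_mat (cbc_matrix m (L0 c20 c11 c02 c10 c01) fc bc \<Delta>r \<Delta>s ri sj))
        \<and> (c10 = 0 \<longrightarrow>
           (\<forall>\<Delta>r \<Delta>s ri sj. 0 < \<Delta>r \<and> 0 < \<Delta>s \<and> noncorner_point fc ri sj \<longrightarrow>
             invertible_mat (cbc_matrix m (L0 c20 c11 c02 c10 c01) fc bc \<Delta>r \<Delta>s ri sj))))
     \<and>
     (\<forall>fc \<in> {BottomFace, TopFace}. \<forall>bc. admissible_bc fc bc \<longrightarrow> c02 > 0 \<longrightarrow>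
        (\<exists>\<delta>>0. \<forall>\<Delta>r \<Delta>s ri sj. 0 < \<Delta>s \<and> \<Delta>s < \<delta> \<and> 0 < \<Delta>r \<and> noncorner_point fc ri sj \<longrightarrow>
           invertible_mat (cbc_matrix m (L0 c20 c11 c02 c10 c01) fc bc \<Delta>r \<Delta>s ri sj))
        \<and> (c01 = 0 \<longrightarrow>
           (\<forall>\<Delta>r \<Delta>s ri sj. 0 < \<Delta>r \<and> 0 < \<Delta>s \<and> noncorner_point fc ri sj \<longrightarrow>
             invertible_mat (cbc_matrix m (L0 c20 c11 c02 c10 c01) fc bc \<Delta>r \<Delta>s ri sj))))"
proof (rule conjI; intro ballI allI impI)
  fix fc bc
  assume *: "fc \<in> {LeftFace, RightFace}" "admissible_bc fc bc" "c20 > 0"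
  obtain \<delta> where "\<delta> > 0"
    and "\<And>\<Delta>r \<Delta>s ri sj. 0 < \<Delta>r \<Longrightarrow> 0 < \<Delta>s \<Longrightarrow> \<Delta>r < \<delta> \<or> c10 = 0 \<Longrightarrow>
      invertible_mat (cbc_matrix m (L0 c20 c11 c02 c10 c01) fc bc \<Delta>r \<Delta>s ri sj)"
    using cbc_unisolvent_small_drift[OF *] invertible_cbc_matrix by metis
  then show "(\<exists>\<delta>>0. \<forall>\<Delta>r \<Delta>s ri sj. 0 < \<Delta>r \<and> \<Delta>r < \<delta> \<and> 0 < \<Delta>s \<and> noncorner_point fc ri sj \<longrightarrow>
           invertible_mat (cbc_matrix m (L0 c20 c11 c02 c10 c01) fc bc \<Delta>r \<Delta>s ri sj))
        \<and> (c10 = 0 \<longrightarrow>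
           (\<forall>\<Delta>r \<Delta>s ri sj. 0 < \<Delta>r \<and> 0 < \<Delta>s \<and> noncorner_point fc ri sj \<longrightarrow>
             invertible_mat (cbc_matrix m (L0 c20 c11 c02 c10 c01) fc bc \<Delta>r \<Delta>s ri sj)))"
    by (intro conjI impI allI exI[of _ \<delta>]) auto
next
  fix fc bc
  assume *: "fc \<in> {BottomFace, TopFace}" "admissible_bc fc bc" "c02 > 0"
  have "swap_face fc \<in> {LeftFace, RightFace}" "admissible_bc (swap_face fc) (swap_bc bc)"
    using * by (cases bc; auto)+
  from cbc_unisolvent_small_drift[OF this *(3), where m = m and ?c11.0 = c11 and ?c02.0 = c20 and ?c10.0 = c01 and ?c01.0 = c10]
  obtain \<delta> where "\<delta> > 0"
    and "\<And>\<Delta>r \<Delta>s ri sj. 0 < \<Delta>s \<Longrightarrow> 0 < \<Delta>r \<Longrightarrow> \<Delta>s < \<delta> \<or> c01 = 0 \<Longrightarrow>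
      cbc_unisolvent m (L0 c02 c11 c20 c01 c10) (swap_face fc) (swap_bc bc) \<Delta>s \<Delta>r sj ri"
    by blast
  then have "\<And>\<Delta>r \<Delta>s ri sj. 0 < \<Delta>s \<Longrightarrow> 0 < \<Delta>r \<Longrightarrow> \<Delta>s < \<delta> \<or> c01 = 0 \<Longrightarrow>
      invertible_mat (cbc_matrix m (L0 c20 c11 c02 c10 c01) fc bc \<Delta>r \<Delta>s ri sj)"
    by (intro invertible_cbc_matrix cbc_unisolvent_bottom_top[OF *(1)])
  with \<open>\<delta> > 0\<close> show "(\<exists>\<delta>>0. \<forall>\<Delta>r \<Delta>s ri sj. 0 < \<Delta>s \<and> \<Delta>s < \<delta> \<and> 0 < \<Delta>r \<and> noncorner_point fc ri sj \<longrightarrow>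
           invertible_mat (cbc_matrix m (L0 c20 c11 c02 c10 c01) fc bc \<Delta>r \<Delta>s ri sj))
        \<and> (c01 = 0 \<longrightarrow>
           (\<forall>\<Delta>r \<Delta>s ri sj. 0 < \<Delta>r \<and> 0 < \<Delta>s \<and> noncorner_point fc ri sj \<longrightarrow>
             invertible_mat (cbc_matrix m (L0 c20 c11 c02 c10 c01) fc bc \<Delta>r \<Delta>s ri sj)))"
    by (intro conjI impI allI exI[of _ \<delta>]) auto
qed

end
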